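(* Let $n\ge 1$. For an $n$-braid $\beta\in B_n$, call the function $[0,1]\to\mathbb{R}$, $t\mapsto d_t(\widehat\beta)-w(\widehat\beta)$, the shape of $d_t(\widehat\beta)$. Then the set of shapes $\{\,t\mapsto d_t(\widehat\beta)-w(\widehat\beta) : \beta\in B_n\,\}$ is finite. Moreover, there is a method for enumerating the possibilities, i.e. an algorithm which, given $n$, outputs a finite list of piecewise linear functions on $[0,1]$ that contains every shape of an $n$-braid.
   Context: $B_n$ is the braid group with Artin generators $\sigma_1,\dots,\sigma_{n-1}$ ($\sigma_i$ a positive crossing). The closure $\widehat\beta$ of $\beta\in B_n$ is viewed as an oriented link in the thickened annulus $A\times I\subset S^3$ (unknotted), with all strands oriented parallel (braid orientation). Let $n_\pm$ be the number of positive/negative crossings of a braid word for $\beta$; the writhe is $w(\widehat\beta)=w(\beta)=n_+-n_-$. Lee complex and $d_t$ (over $\mathbb{Q}$): let $V=\mathbb{Q}\langle v_+,v_-\rangle$. For each vertex $v\in\{0,1\}^{\text{crossings}}$ of the cube of resolutions of the diagram $\widehat\beta$, take the complete resolution $D_v$ (a collection of circles in the annulus); the distinguished generators at $v$ are the labelings of the circles of $D_v$ by $+$ or $-$ (i.e. by $v_+$ or $v_-$). A distinguished generator has homological grading $i=|v|-n_-$, quantum grading $j=\#(+)-\#(-)+|v|+n_+-2n_-$, and annular grading $k=\#(+)-\#(-)$ counted only over circles that wrap around the annulus. The Lee differential $\partial+\Phi$ is the signed sum over edges of the cube of merge maps $m(v_+\otimes v_+)=v_+$, $m(v_+\otimes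 v_-)=m(v_-\otimes v_+)=v_-$, $m(v_-\otimes v_-)=v_+$ and split maps $\Delta(v_+)=v_+\otimes v_-+v_-\otimes v_+$, $\Delta(v_-)=v_-\otimes v_-+v_+\otimes v_+$. Its homology is $\mathrm{Lee}(\widehat\beta)$. Let $\mathfrak{s}_o$ be Lee's canonical cycle for the braid orientation $o$: in the oriented resolution ($n$ concentric circles) label the circles alternately by $v_-+v_+$ and $v_--v_+$. For $t\in[0,2]$ put $j_t=j-tk$ on distinguished generators; for a nonzero chain $x$, $j_t(x)$ is the minimum of $j_t$ over the distinguished generators occurring in $x$ with nonzero coefficient. The annular Rasmussen invariant is $d_t(\widehat\beta)=\max\{j_t(x): x\text{ a cycle},\ [x]=[\mathfrak{s}_o]\}$. It is an invariant of the annular link $\widehat\beta$, and it satisfies $d_{1-t}=d_{1+t}$, so one restricts to $t\in[0,1]$. *)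

theory Defs
  imports Complex_Main "HOL-Library.FuncSet" "HOL-Library.Nat_Bijection" "HOL-Library.Countable"
begin

section \<open>Braids\<close>

text \<open>The letter \<open>(i, True)\<close> is the Artin generator \<open>\<sigma>\<^sub>i\<close> (a positive crossing of the strands
  in positions \<open>i\<close> and \<open>i + 1\<close>), and \<open>(i, False)\<close> is its inverse.\<close>

type_synonym braid_word = "(nat \<times> bool) list"

definition braid_words :: "nat \<Rightarrow> braid_word set" where
  "braid_words n = {w. \<forall>(i, e) \<in> set w. 1 \<le> i \<and> i < n}"

inductive braid_eq :: "nat \<Rightarrow> braid_word \<Rightarrow> braid_word \<Rightarrow> bool" for n where
  refl: "w \<in> braid_words n \<Longrightarrow> braid_eq n w w"
| sym: "braid_eq n u v \<Longrightarrow> braid_eq n v u"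
| trans: "braid_eq n u v \<Longrightarrow> braid_eq n v w \<Longrightarrow> braid_eq n u w"
| append: "braid_eq n u u' \<Longrightarrow> braid_eq n v v' \<Longrightarrow> braid_eq n (u @ v) (u' @ v')"
| cancel: "1 \<le> i \<Longrightarrow> i < n \<Longrightarrow> braid_eq n [(i, e), (i, \<not> e)] []"
| commute: "1 \<le> i \<Longrightarrow> i + 2 \<le> j \<Longrightarrow> j < n \<Longrightarrow>
    braid_eq n [(i, True), (j, True)] [(j, True), (i, True)]"
| braid: "1 \<le> i \<Longrightarrow> i + 1 < n \<Longrightarrow>
    braid_eq n [(i, True), (i + 1, True), (i, True)] [(i + 1, True), (i, True), (i + 1, True)]"

text \<open>The underlying set of \<open>B\<^sub>n\<close>: a braid is the set of all words representing it.\<close>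

definition braid_group :: "nat \<Rightarrow> braid_word set set" where
  "braid_group n = braid_words n // {(u, v). braid_eq n u v}"

lemma braid_eq_words: "braid_eq n u v \<Longrightarrow> u \<in> braid_words n \<and> v \<in> braid_words n"
  by (induction rule: braid_eq.induct) (auto simp: braid_words_def)

lemma equiv_braid_eq: "equiv (braid_words n) {(u, v). braid_eq n u v}"
  by (rule equivI)
    (auto simp: refl_on_def sym_def trans_def dest: braid_eq_words
      intro: braid_eq.refl braid_eq.sym braid_eq.trans)

definition n_pos :: "braid_word \<Rightarrow> nat" where
  "n_pos w = card {c. c < length w \<and> snd (w ! c)}"

definition n_neg :: "braid_word \<Rightarrow> nat" where
  "n_neg w = card {c. c < length w \<and> \<not> snd (w ! c)}"

definition writhe :: "braid_word \<Rightarrow> int" where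
  "writhe w = int (n_pos w) - int (n_neg w)"


section \<open>Resolutions of the closed braid diagram\<close>

text \<open>The closure of a word \<open>w\<close> of length \<open>L\<close> on \<open>n\<close> strands is drawn through the points \<open>(p, h)\<close>
  with position \<open>p \<in> {1..n}\<close> and height \<open>h \<in> {0..L}\<close>. Crossing number \<open>c < L\<close> lies between the
  heights \<open>c\<close> and \<open>c + 1\<close>, and the closing strands join \<open>(p, L)\<close> to \<open>(p, 0)\<close>, running
  once around the annulus. A vertex of the cube of resolutions is given by the set \<open>v\<close> of the
  crossings that receive the 1-resolution. The 0-resolution of a positive crossing and the
  1-resolution of a negative crossing are the oriented (vertical) ones; the other two resolutions
  are turnbacks.\<close>

type_synonym point = "nat \<times> nat"
type_synonym circle = "point set"

definition points :: "nat \<Rightarrow> braid_word \<Rightarrow> point set" where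
  "points n w = {1..n} \<times> {0..length w}"

definition turnback :: "braid_word \<Rightarrow> nat set \<Rightarrow> nat \<Rightarrow> bool" where
  "turnback w v c \<longleftrightarrow> (snd (w ! c) \<longleftrightarrow> c \<in> v)"

definition arcs :: "nat \<Rightarrow> braid_word \<Rightarrow> nat set \<Rightarrow> (point \<times> point) set" where
  "arcs n w v =
     {((p, c), (p, Suc c)) | p c. p \<in> {1..n} \<and> c < length w \<and>
        \<not> (turnback w v c \<and> p \<in> {fst (w ! c), Suc (fst (w ! c))})}
   \<union> {((fst (w ! c), h), (Suc (fst (w ! c)), h)) | c h. c < length w \<and>
        turnback w v c \<and> h \<in> {c, Suc c}}
   \<union> {((p, length w), (p, 0)) | p. p \<in> {1..n}}"

definition circles :: "nat \<Rightarrow> braid_word \<Rightarrow> nat set \<Rightarrow> circle set" where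
  "circles n w v = points n w // (arcs n w v \<union> (arcs n w v)\<inverse>)\<^sup>*"

text \<open>A simple closed curve in the annulus wraps around it iff it crosses a radial cut an odd number
  of times. The cut used here meets precisely the closing strands, each of them once.\<close>

definition wraps :: "nat \<Rightarrow> braid_word \<Rightarrow> circle \<Rightarrow> bool" where
  "wraps n w K \<longleftrightarrow> odd (card {p \<in> {1..n}. (p, length w) \<in> K})"


section \<open>The Lee complex\<close>

datatype sign = Plus | Minus

fun sgn_val :: "sign \<Rightarrow> int" where
  "sgn_val Plus = 1"
| "sgn_val Minus = - 1"

type_synonym gen = "nat set \<times> (circle \<Rightarrow> sign)"
type_synonym chain = "gen \<Rightarrow> rat"

definition gens :: "nat \<Rightarrow> braid_word \<Rightarrow> gen set" where
  "gens n w = (SIGMA v : Pow {..<length w}. circles n w v \<rightarrow>\<^sub>E UNIV)"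

definition chains :: "nat \<Rightarrow> braid_word \<Rightarrow> chain set" where
  "chains n w = {x. \<forall>g. g \<notin> gens n w \<longrightarrow> x g = 0}"

definition j_grading :: "nat \<Rightarrow> braid_word \<Rightarrow> gen \<Rightarrow> int" where
  "j_grading n w = (\<lambda>(v, l). (\<Sum>K\<in>circles n w v. sgn_val (l K))
     + int (card v) + int (n_pos w) - 2 * int (n_neg w))"

definition k_grading :: "nat \<Rightarrow> braid_word \<Rightarrow> gen \<Rightarrow> int" where
  "k_grading n w = (\<lambda>(v, l). \<Sum>K\<in>{K \<in> circles n w v. wraps n w K}. sgn_val (l K))"

text \<open>A product of two basis vectors of \<open>V\<close> is again a basis vector. A coproduct of a basis vector is
  a sum of distinct tensors of basis vectors, given as the set of these tensors.\<close>

fun lee_m :: "sign \<Rightarrow> sign \<Rightarrow> sign" where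
  "lee_m Plus Plus = Plus"
| "lee_m Plus Minus = Minus"
| "lee_m Minus Plus = Minus"
| "lee_m Minus Minus = Plus"

fun lee_Delta :: "sign \<Rightarrow> (sign \<times> sign) set" where
  "lee_Delta Plus = {(Plus, Minus), (Minus, Plus)}"
| "lee_Delta Minus = {(Minus, Minus), (Plus, Plus)}"

text \<open>\<open>lee_edge C l C' l'\<close> says that the labelling \<open>l'\<close> of the circles \<open>C'\<close> occurs in the image of
  the labelling \<open>l\<close> of the circles \<open>C\<close> under the (unsigned) edge map. It then occurs with
  coefficient 1.\<close>

definition lee_edge ::
  "circle set \<Rightarrow> (circle \<Rightarrow> sign) \<Rightarrow> circle set \<Rightarrow> (circle \<Rightarrow> sign) \<Rightarrow> bool" where
  "lee_edge C l C' l' \<longleftrightarrow>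
     (\<forall>K\<in>C \<inter> C'. l' K = l K) \<and>
     ((\<exists>A B M. A \<noteq> B \<and> C - C' = {A, B} \<and> C' - C = {M} \<and> l' M = lee_m (l A) (l B)) \<or>
      (\<exists>M A B. A \<noteq> B \<and> C - C' = {M} \<and> C' - C = {A, B} \<and> (l' A, l' B) \<in> lee_Delta (l M)))"

definition edge_sign :: "nat set \<Rightarrow> nat \<Rightarrow> rat" where
  "edge_sign v c = (- 1) ^ card {b \<in> v. b < c}"

definition lee_coeff :: "nat \<Rightarrow> braid_word \<Rightarrow> gen \<Rightarrow> gen \<Rightarrow> rat" where
  "lee_coeff n w = (\<lambda>(v, l) (v', l').
     \<Sum>c\<in>{..<length w} - v.
       if v' = insert c v \<and> lee_edge (circles n w v) l (circles n w v') l'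
       then edge_sign v c else 0)"

definition lee_d :: "nat \<Rightarrow> braid_word \<Rightarrow> chain \<Rightarrow> chain" where
  "lee_d n w x = (\<lambda>g'. if g' \<in> gens n w then \<Sum>g\<in>gens n w. lee_coeff n w g g' * x g else 0)"

definition lee_cycles :: "nat \<Rightarrow> braid_word \<Rightarrow> chain set" where
  "lee_cycles n w = {x \<in> chains n w. \<forall>g. lee_d n w x g = 0}"

definition homologous :: "nat \<Rightarrow> braid_word \<Rightarrow> chain \<Rightarrow> chain \<Rightarrow> bool" where
  "homologous n w x x' \<longleftrightarrow> (\<exists>y\<in>chains n w. \<forall>g. x g - x' g = lee_d n w y g)"

definition oriented_vertex :: "braid_word \<Rightarrow> nat set" where
  "oriented_vertex w = {c. c < length w \<and> \<not> snd (w ! c)}"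

text \<open>The circles of the oriented resolution are the concentric circles \<open>{p} \<times> {0..L}\<close>. Those with
  \<open>p\<close> even are labelled \<open>v\<^sub>- + v\<^sub>+\<close> and those with \<open>p\<close> odd are labelled \<open>v\<^sub>- - v\<^sub>+\<close>.\<close>

definition canonical_cycle :: "nat \<Rightarrow> braid_word \<Rightarrow> chain" where
  "canonical_cycle n w = (\<lambda>(v, l).
     if (v, l) \<in> gens n w \<and> v = oriented_vertex w
     then \<Prod>p\<in>{1..n}. if odd p \<and> l ({p} \<times> {0..length w}) = Plus then - 1 else 1
     else 0)"


section \<open>The annular Rasmussen invariant and its shape\<close>

definition jt_gen :: "nat \<Rightarrow> braid_word \<Rightarrow> real \<Rightarrow> gen \<Rightarrow> real" where
  "jt_gen n w t g = of_int (j_grading n w g) - t * of_int (k_grading n w g)"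

text \<open>Only meaningful for nonzero chains. The zero chain does not represent the class of the canonical
  cycle, as that class is nonzero.\<close>

definition jt_chain :: "nat \<Rightarrow> braid_word \<Rightarrow> real \<Rightarrow> chain \<Rightarrow> real" where
  "jt_chain n w t x = Min {jt_gen n w t g | g. g \<in> gens n w \<and> x g \<noteq> 0}"

definition annular_d :: "nat \<Rightarrow> braid_word \<Rightarrow> real \<Rightarrow> real" where
  "annular_d n w t = Max {jt_chain n w t x | x.
     x \<in> lee_cycles n w \<and> homologous n w x (canonical_cycle n w)}"

text \<open>Functions on \<open>[0,1]\<close> are functions on the reals that are undefined outside \<open>[0,1]\<close>.\<close>

definition shape :: "nat \<Rightarrow> braid_word \<Rightarrow> real \<Rightarrow> real" where
  "shape n w = (\<lambda>t\<in>{0..1}. annular_d n w t - of_int (writhe w))"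

text \<open>Every braid contributes the shapes computed from all of its words; by invariance of
  \<open>annular_d\<close> and of the writhe these agree.\<close>

definition shapes :: "nat \<Rightarrow> (real \<Rightarrow> real) set" where
  "shapes n = {shape n w | \<beta> w. \<beta> \<in> braid_group n \<and> w \<in> \<beta>}"


section \<open>Piecewise linear functions and their finite descriptions\<close>

text \<open>The pieces are closed intervals overlapping in the breakpoints, so continuity is included.\<close>

definition piecewise_linear :: "(real \<Rightarrow> real) \<Rightarrow> bool" where
  "piecewise_linear F \<longleftrightarrow> (\<exists>(m :: nat) \<tau> a b. \<tau> 0 = 0 \<and> \<tau> m = 1 \<and>
     (\<forall>i<m. \<tau> i < \<tau> (Suc i) \<and> (\<forall>t\<in>{\<tau> i..\<tau> (Suc i)}. F t = a i * t + b i)))"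

text \<open>A nonempty list \<open>[y\<^sub>0, \<dots>, y\<^sub>N]\<close> of rationals describes the function on \<open>[0,1]\<close> that has value
  \<open>y\<^sub>i\<close> at \<open>i / N\<close> and is linear in between (a combination of hat functions; constant if
  \<open>N = 0\<close>). Every piecewise linear function with rational breakpoints and rational values there has
  such a description.\<close>

definition pl_function :: "rat list \<Rightarrow> real \<Rightarrow> real" where
  "pl_function ys = (\<lambda>t\<in>{0..1}. \<Sum>i<length ys.
     of_rat (ys ! i) * max 0 (1 - \<bar>real (length ys - 1) * t - real i\<bar>))"

text \<open>A natural number encodes, effectively, a finite list of finite lists of rationals.\<close>

definition decode_pl_list :: "nat \<Rightarrow> (real \<Rightarrow> real) list" where
  "decode_pl_list m = map (\<lambda>c. pl_function (map nat_to_rat_surj (list_decode c))) (list_decode m)"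


section \<open>Recursive functions\<close>

datatype recf =
    Zero
  | Succ
  | Proj nat
  | Comp recf "recf list"
  | PrimRec recf recf
  | Mu recf

inductive rec_eval :: "recf \<Rightarrow> nat list \<Rightarrow> nat \<Rightarrow> bool" where
  Zero: "rec_eval Zero xs 0"
| Succ: "rec_eval Succ [x] (Suc x)"
| Proj: "i < length xs \<Longrightarrow> rec_eval (Proj i) xs (xs ! i)"
| Comp: "list_all2 (\<lambda>g y. rec_eval g xs y) gs ys \<Longrightarrow> rec_eval f ys z \<Longrightarrow>
    rec_eval (Comp f gs) xs z"
| PrimRec_0: "rec_eval f xs y \<Longrightarrow> rec_eval (PrimRec f g) (0 # xs) y"
| PrimRec_Suc: "rec_eval (PrimRec f g) (m # xs) r \<Longrightarrow> rec_eval g (m # r # xs) y \<Longrightarrow>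
    rec_eval (PrimRec f g) (Suc m # xs) y"
| Mu: "rec_eval f (m # xs) 0 \<Longrightarrow> (\<forall>k<m. \<exists>y. rec_eval f (k # xs) (Suc y)) \<Longrightarrow>
    rec_eval (Mu f) xs m"

definition computable :: "(nat \<Rightarrow> nat) \<Rightarrow> bool" where
  "computable f \<longleftrightarrow> (\<exists>e. \<forall>n. rec_eval e [n] (f n))"

end

theory Submission
  imports Defs
begin

text \<open>The coefficients of the canonical cycle change sign when the labels of two adjacent concentric
  circles are both reversed, whereas the edge maps merging or separating these circles are invariant
  under that reversal. Hence the canonical cycle is a cycle, and pairing with it is a cocycle. So every
  representative of its class has a term in the oriented resolution, where \<open>j = k + w\<close> and
  \<open>\<bar>k\<bar> \<le> n\<close>; comparing with the canonical cycle itself, \<open>\<bar>d\<^sub>t - w\<bar> \<le> n\<close> on \<open>[0,1]\<close>.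

  Moreover \<open>d\<^sub>t - w\<close> is a maximum of minima of lines \<open>b - t k\<close> with integral \<open>b\<close> and \<open>k\<close> and
  \<open>\<bar>k\<bar> \<le> n\<close>. With \<open>N = (2 n)!\<close>, no two such lines cross inside an interval
  \<open>[i / N, (i + 1) / N]\<close>, so one of them realises \<open>d\<^sub>t - w\<close> on the whole interval. The shape is
  therefore the linear interpolation of its values at the points \<open>i / N\<close>, which are among the
  finitely many fractions \<open>q / N\<close> with \<open>\<bar>q\<bar> \<le> n N\<close>. Since every list of rationals describes a
  piecewise linear function, it suffices to enumerate all codes up to a computable bound.\<close>


section \<open>Circles near the oriented resolution\<close>

abbreviation joined :: "nat \<Rightarrow> braid_word \<Rightarrow> nat set \<Rightarrow> (point \<times> point) set" where
  "joined n w v \<equiv> (arcs n w v \<union> (arcs n w v)\<inverse>)\<^sup>*"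

definition column :: "braid_word \<Rightarrow> nat \<Rightarrow> circle" where
  "column w p = {p} \<times> {0..length w}"

lemma column_eq_iff [simp]: "column w p = column w q \<longleftrightarrow> p = q"
  by (auto simp: column_def times_eq_iff)

lemma sym_joined: "sym (joined n w v)"
  by (intro sym_rtrancl) (auto simp: sym_def)

lemma equiv_joined: "equiv UNIV (joined n w v)"
  by (intro equivI sym_joined) (auto intro: refl_rtrancl trans_rtrancl)

lemma circles_disjoint:
  assumes "K \<in> circles n w v" "K' \<in> circles n w v" "x \<in> K" "x \<in> K'"
  shows "K = K'"
proof -
  have "K \<in> UNIV // joined n w v" "K' \<in> UNIV // joined n w v"
    using assms(1,2) unfolding circles_def quotient_def by blast+
  then show ?thesis
    using quotient_disj[OF equiv_joined] assms(3,4) by blast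
qed

lemma circles_closed:
  assumes "K \<in> circles n w v" "x \<in> K" "(x, y) \<in> arcs n w v"
  shows "y \<in> K"
  using assms unfolding circles_def quotient_def
  by (auto intro: rtrancl_into_rtrancl)

lemma finite_circles [simp]: "finite (circles n w v)"
  unfolding circles_def quotient_def points_def by auto

lemma finite_UNIV_sign [simp]: "finite (UNIV :: sign set)"
proof -
  have "(UNIV :: sign set) = {Plus, Minus}"
    using sign.exhaust by blast
  then show ?thesis
    by (metis finite.emptyI finite.insertI)
qed

lemma finite_gens [simp]: "finite (gens n w)"
  unfolding gens_def by (intro finite_SigmaI finite_PiE) auto

text \<open>Without turnbacks at position \<open>p\<close> every arc meeting the column is vertical
  or closing, so a path cannot leave it; climbing from height 0 reaches all of it.\<close>

lemma joined_column:
  assumes p: "p \<in> {1..n}" and h: "h \<le> length w"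
    and vertical: "\<And>c. c < length w \<Longrightarrow> turnback w v c \<Longrightarrow> p \<noteq> fst (w ! c) \<and> p \<noteq> Suc (fst (w ! c))"
  shows "joined n w v `` {(p, h)} = column w p"
proof
  show "joined n w v `` {(p, h)} \<subseteq> column w p"
  proof
    fix y assume "y \<in> joined n w v `` {(p, h)}"
    then have "((p, h), y) \<in> joined n w v" by simp
    then show "y \<in> column w p"
    proof (induction rule: rtrancl_induct)
      case base
      then show ?case using h by (simp add: column_def)
    next
      case (step y z)
      then show ?case
        using vertical unfolding column_def arcs_def by auto
    qed
  qed
  have up: "((p, 0), (p, h)) \<in> joined n w v" if "h \<le> length w" for h
    using that
  proof (induction h)
    case (Suc h)
    have "((p, h), (p, Suc h)) \<in> arcs n w v"
      using Suc.prems p vertical[of h] unfolding arcs_def by auto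
    with Suc show ?case
      by (meson Suc_leD UnI1 rtrancl.rtrancl_into_rtrancl)
  qed simp
  show "column w p \<subseteq> joined n w v `` {(p, h)}"
  proof
    fix y assume "y \<in> column w p"
    then obtain h' where "y = (p, h')" "h' \<le> length w"
      by (auto simp: column_def)
    then show "y \<in> joined n w v `` {(p, h)}"
      using up[OF h] up[of h'] sym_joined[of n w v]
      by (auto dest: symD intro: rtrancl_trans)
  qed
qed

lemma column_in_circles:
  assumes "p \<in> {1..n}"
    and "\<And>c. c < length w \<Longrightarrow> turnback w v c \<Longrightarrow> p \<noteq> fst (w ! c) \<and> p \<noteq> Suc (fst (w ! c))"
  shows "column w p \<in> circles n w v"
proof -
  have "column w p = joined n w v `` {(p, 0)}"
    using joined_column[OF assms(1) _ assms(2)] by simp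
  moreover have "(p, 0) \<in> points n w"
    using assms(1) by (auto simp: points_def)
  ultimately show ?thesis
    unfolding circles_def by (metis quotientI)
qed

lemma turnback_oriented_vertex: "c < length w \<Longrightarrow> \<not> turnback w (oriented_vertex w) c"
  by (auto simp: turnback_def oriented_vertex_def)

lemma circles_oriented_vertex: "circles n w (oriented_vertex w) = column w ` {1..n}"
proof
  show "circles n w (oriented_vertex w) \<subseteq> column w ` {1..n}"
  proof
    fix K assume "K \<in> circles n w (oriented_vertex w)"
    then obtain p h where ph: "p \<in> {1..n}" "h \<le> length w"
      and K: "K = joined n w (oriented_vertex w) `` {(p, h)}"
      unfolding circles_def quotient_def points_def by auto
    have "K = column w p"
      unfolding K using ph turnback_oriented_vertex by (intro joined_column) auto
    with ph show "K \<in> column w ` {1..n}" by blast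
  qed
  show "column w ` {1..n} \<subseteq> circles n w (oriented_vertex w)"
    using turnback_oriented_vertex by (auto intro!: column_in_circles)
qed

lemma braid_words_nth:
  assumes "w \<in> braid_words n" "c < length w"
  shows "1 \<le> fst (w ! c)" "fst (w ! c) < n"
  using assms(1) nth_mem[OF assms(2)] unfolding braid_words_def by (cases "w ! c"; auto)+

text \<open>The single turnback joins columns \<open>i\<close> and \<open>i + 1\<close>, so neither
  remains a circle, while all other columns survive. Phrasing the hypothesis through
  \<open>turnback\<close> covers both the edges leaving the oriented vertex (positive
  \<open>c\<close>) and those entering it (negative \<open>c\<close>).\<close>

lemma circles_oriented_vertex_diff:
  assumes w: "w \<in> braid_words n" and c: "c < length w"
    and v: "\<And>c'. c' < length w \<Longrightarrow> turnback w v c' \<longleftrightarrow> c' = c"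
  shows "circles n w (oriented_vertex w) - circles n w v
    = {column w (fst (w ! c)), column w (Suc (fst (w ! c)))}"
proof -
  define i where "i = fst (w ! c)"
  have i: "1 \<le> i" "i < n"
    using braid_words_nth[OF w c] by (simp_all add: i_def)
  have arc: "((i, c), (Suc i, c)) \<in> arcs n w v"
    using c v[OF c] unfolding arcs_def i_def by auto
  have "column w p \<in> circles n w v \<longleftrightarrow> p \<noteq> i \<and> p \<noteq> Suc i" if p: "p \<in> {1..n}" for p
  proof
    assume K: "column w p \<in> circles n w v"
    show "p \<noteq> i \<and> p \<noteq> Suc i"
    proof (rule ccontr)
      assume "\<not> (p \<noteq> i \<and> p \<noteq> Suc i)"
      then consider "p = i" | "p = Suc i" by blast
      then show False
      proof cases
        case 1
        then have "(Suc i, c) \<in> column w p"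
          using circles_closed[OF K _ arc] c by (simp add: column_def)
        with 1 show False by (simp add: column_def)
      next
        case 2
        \<comment> \<open>The arc is traversed backwards here, so \<open>circles_closed\<close>,
          which follows arcs forwards, is replaced by the symmetric closure.\<close>
        have "((Suc i, c), (i, c)) \<in> joined n w v"
          using arc by blast
        moreover obtain x where "column w p = joined n w v `` {x}"
          using K unfolding circles_def quotient_def by blast
        moreover have "(Suc i, c) \<in> column w p"
          using 2 c by (simp add: column_def)
        ultimately have "(i, c) \<in> column w p"
          by (auto intro: rtrancl_trans)
        with 2 show False by (simp add: column_def)
      qed
    qed
  next
    assume "p \<noteq> i \<and> p \<noteq> Suc i"
    then show "column w p \<in> circles n w v"
      using p v by (intro column_in_circles) (auto simp: i_def)
  qed
  then show ?thesis
    using i unfolding circles_oriented_vertex i_def[symmetric] by auto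
qed


section \<open>The canonical cycle and its dual cocycle\<close>

fun opposite :: "sign \<Rightarrow> sign" where
  "opposite Plus = Minus"
| "opposite Minus = Plus"

lemma opposite_opposite [simp]: "opposite (opposite s) = s"
  by (cases s) auto

definition flip :: "circle \<Rightarrow> circle \<Rightarrow> (circle \<Rightarrow> sign) \<Rightarrow> circle \<Rightarrow> sign" where
  "flip A B l = l(A := opposite (l A), B := opposite (l B))"

lemma flip_flip: "A \<noteq> B \<Longrightarrow> flip A B (flip A B l) = l"
  by (auto simp: flip_def)

lemma flip_simps:
  "A \<noteq> B \<Longrightarrow> flip A B l A = opposite (l A)"
  "flip A B l B = opposite (l B)"
  "K \<noteq> A \<Longrightarrow> K \<noteq> B \<Longrightarrow> flip A B l K = l K"
  by (auto simp: flip_def)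

lemma flip_PiE: "A \<in> C \<Longrightarrow> B \<in> C \<Longrightarrow> l \<in> C \<rightarrow>\<^sub>E UNIV \<Longrightarrow> flip A B l \<in> C \<rightarrow>\<^sub>E UNIV"
  by (auto simp: flip_def PiE_iff extensional_def)

text \<open>In the Lee algebra Q[X]/(X^2 - 1) with v_+ = 1 and v_- = X, reversing a label is
  multiplication by X. As X^2 = 1, multiplying both factors by X does not change the product; the
  coproduct, being a bimodule map, is likewise fixed by X \<otimes> X.\<close>

lemma lee_m_opposite [simp]: "lee_m (opposite a) (opposite b) = lee_m a b"
  by (cases a; cases b) auto

lemma lee_Delta_opposite [simp]:
  "(opposite a, opposite b) \<in> lee_Delta s \<longleftrightarrow> (a, b) \<in> lee_Delta s"
  by (cases a; cases b; cases s) auto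

text \<open>Two circles disappear, so the edge is a merge of exactly these two.\<close>

lemma lee_edge_flip_source_imp:
  assumes "C - C' = {A, B}" "A \<noteq> B" "lee_edge C l C' l'"
  shows "lee_edge C (flip A B l) C' l'"
proof -
  have eq: "\<forall>K\<in>C \<inter> C'. l' K = flip A B l K"
    using assms by (auto simp: lee_edge_def flip_def)
  have "\<not> (\<exists>M. C - C' = {M})"
    using assms(1,2) by auto
  with assms(3) obtain A' B' M where *: "A' \<noteq> B'" "C - C' = {A', B'}" "C' - C = {M}"
    "l' M = lee_m (l A') (l B')"
    unfolding lee_edge_def by metis
  have "A' = A \<and> B' = B \<or> A' = B \<and> B' = A"
    using *(2) assms(1) by (auto simp: doubleton_eq_iff)
  then have "l' M = lee_m (flip A B l A') (flip A B l B')"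
    using *(4) flip_simps(1)[OF assms(2)] flip_simps(2) by auto
  with eq * show ?thesis
    unfolding lee_edge_def by metis
qed

lemma lee_edge_flip_source:
  assumes "C - C' = {A, B}" "A \<noteq> B"
  shows "lee_edge C (flip A B l) C' l' \<longleftrightarrow> lee_edge C l C' l'"
  using lee_edge_flip_source_imp[OF assms] flip_flip[OF assms(2)] by metis

text \<open>Two circles appear, so the edge is a split into exactly these two.\<close>

lemma lee_edge_flip_target_imp:
  assumes "C' - C = {A, B}" "A \<noteq> B" "lee_edge C l C' l'"
  shows "lee_edge C l C' (flip A B l')"
proof -
  have eq: "\<forall>K\<in>C \<inter> C'. flip A B l' K = l K"
    using assms by (auto simp: lee_edge_def flip_def)
  have "\<not> (\<exists>M. C' - C = {M})"
    using assms(1,2) by auto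
  with assms(3) obtain A' B' M where *: "A' \<noteq> B'" "C - C' = {M}" "C' - C = {A', B'}"
    "(l' A', l' B') \<in> lee_Delta (l M)"
    unfolding lee_edge_def by metis
  have "A' = A \<and> B' = B \<or> A' = B \<and> B' = A"
    using *(3) assms(1) by (auto simp: doubleton_eq_iff)
  then have "(flip A B l' A', flip A B l' B') \<in> lee_Delta (l M)"
    using *(4) flip_simps(1)[OF assms(2)] flip_simps(2) by auto
  with eq * show ?thesis
    unfolding lee_edge_def by metis
qed

lemma lee_edge_flip_target:
  assumes "C' - C = {A, B}" "A \<noteq> B"
  shows "lee_edge C l C' (flip A B l') \<longleftrightarrow> lee_edge C l C' l'"
  using lee_edge_flip_target_imp[OF assms] flip_flip[OF assms(2)] by metis

section \<open>The canonical cycle as a cycle and as a cocycle\<close>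

lemma gens_iff: "(v, l) \<in> gens n w \<longleftrightarrow> v \<subseteq> {..<length w} \<and> l \<in> circles n w v \<rightarrow>\<^sub>E UNIV"
  by (auto simp: gens_def)

lemma oriented_vertex_subset: "oriented_vertex w \<subseteq> {..<length w}"
  by (auto simp: oriented_vertex_def)

text \<open>Reversal fixes v_- + v_+ and negates v_- - v_+. Of two adjacent positions exactly one is
  odd, so exactly one factor of the product changes sign.\<close>

lemma canonical_cycle_flip:
  assumes i: "1 \<le> i" "i < n" and l: "l \<in> circles n w (oriented_vertex w) \<rightarrow>\<^sub>E UNIV"
  shows "canonical_cycle n w (oriented_vertex w, flip (column w i) (column w (Suc i)) l)
    = - canonical_cycle n w (oriented_vertex w, l)"
proof -
  define l' where "l' = flip (column w i) (column w (Suc i)) l"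
  define a where "a l p = (if odd p \<and> l (column w p) = Plus then - 1 else (1 :: rat))" for l p
  have l': "l' \<in> circles n w (oriented_vertex w) \<rightarrow>\<^sub>E UNIV"
    unfolding l'_def using i l by (intro flip_PiE) (auto simp: circles_oriented_vertex)
  have coeff: "canonical_cycle n w (oriented_vertex w, m) = (\<Prod>p\<in>{1..n}. a m p)"
    if "m \<in> circles n w (oriented_vertex w) \<rightarrow>\<^sub>E UNIV" for m
    using that oriented_vertex_subset
    by (simp add: canonical_cycle_def gens_iff a_def column_def)
  have split: "(\<Prod>p\<in>{1..n}. a m p) = a m i * a m (Suc i) * (\<Prod>p\<in>{1..n} - {i, Suc i}. a m p)" for m
  proof -
    have "(\<Prod>p\<in>{1..n}. a m p) = (\<Prod>p\<in>{i, Suc i}. a m p) * (\<Prod>p\<in>{1..n} - {i, Suc i}. a m p)"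
      using i by (subst mult.commute, intro prod.subset_diff) auto
    then show ?thesis by simp
  qed
  have "(\<Prod>p\<in>{1..n} - {i, Suc i}. a l' p) = (\<Prod>p\<in>{1..n} - {i, Suc i}. a l p)"
    by (rule prod.cong) (auto simp: a_def l'_def flip_simps)
  moreover have "a l' i * a l' (Suc i) = - (a l i * a l (Suc i))"
    by (cases "l (column w i)"; cases "l (column w (Suc i))")
      (auto simp: a_def l'_def flip_simps)
  ultimately show ?thesis
    using coeff[OF l] coeff[OF l'] split[of l] split[of l'] by (simp add: l'_def)
qed

text \<open>The reversal is a sign-reversing involution on the summands, so the sum equals its own
  negative. It is applied with \<open>H\<close> a column or a row of the matrix
  \<open>lee_coeff\<close>.\<close>

lemma canonical_cycle_orthogonal:
  assumes i: "1 \<le> i" "i < n"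
    and H: "\<And>l. H (oriented_vertex w, flip (column w i) (column w (Suc i)) l) = H (oriented_vertex w, l)"
  shows "(\<Sum>g\<in>gens n w. canonical_cycle n w g * H g) = 0"
proof -
  let ?v = "oriented_vertex w"
  let ?P = "circles n w ?v \<rightarrow>\<^sub>E (UNIV :: sign set)"
  let ?f = "flip (column w i) (column w (Suc i))"
  let ?F = "\<lambda>l. canonical_cycle n w (?v, l) * H (?v, l)"
  have flip_P: "?f l \<in> ?P" if "l \<in> ?P" for l
    using that i by (intro flip_PiE) (auto simp: circles_oriented_vertex)
  have "(\<Sum>g\<in>gens n w. canonical_cycle n w g * H g)
      = (\<Sum>g\<in>Pair ?v ` ?P. canonical_cycle n w g * H g)"
    using oriented_vertex_subset
    by (intro sum.mono_neutral_right) (auto simp: gens_iff canonical_cycle_def)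
  also have "\<dots> = (\<Sum>l\<in>?P. ?F l)"
    by (subst sum.reindex) (auto simp: inj_on_def)
  also have "\<dots> = 0"
  proof -
    have "(\<Sum>l\<in>?P. ?F l) = (\<Sum>l\<in>?P. - ?F l)"
      by (rule sum.reindex_bij_witness[of _ ?f ?f])
        (auto simp: flip_flip H canonical_cycle_flip[OF i] intro!: flip_P)
    then show ?thesis by (simp add: sum_negf)
  qed
  finally show ?thesis .
qed

lemma canonical_cycle_closed:
  assumes w: "w \<in> braid_words n"
  shows "(\<Sum>g\<in>gens n w. canonical_cycle n w g * lee_coeff n w g g') = 0"
proof (cases "\<exists>c\<in>{..<length w} - oriented_vertex w. fst g' = insert c (oriented_vertex w)")
  case True
  then obtain c where c: "c < length w" "c \<notin> oriented_vertex w"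
    and g': "fst g' = insert c (oriented_vertex w)" by auto
  \<comment> \<open>\<open>c\<close> lies outside the oriented vertex, so it is a positive crossing
    and its 1-resolution is a turnback.\<close>
  have "turnback w (fst g') c' \<longleftrightarrow> c' = c" if "c' < length w" for c'
    using that c unfolding g' turnback_def oriented_vertex_def by auto
  from circles_oriented_vertex_diff[OF w c(1) this]
  have "lee_edge (circles n w (oriented_vertex w))
        (flip (column w (fst (w ! c))) (column w (Suc (fst (w ! c)))) l)
        (circles n w (fst g')) l'
      \<longleftrightarrow> lee_edge (circles n w (oriented_vertex w)) l (circles n w (fst g')) l'" for l l'
    by (intro lee_edge_flip_source) auto
  then show ?thesis
    by (intro canonical_cycle_orthogonal[OF braid_words_nth[OF w c(1)]])
      (auto simp: lee_coeff_def split: prod.splits)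
next
  case False
  have "canonical_cycle n w g * lee_coeff n w g g' = 0" for g
    using False by (cases g; cases g') (auto simp: canonical_cycle_def lee_coeff_def intro!: sum.neutral)
  then show ?thesis by (intro sum.neutral) blast
qed

text \<open>The transpose of the previous argument: now the edges enter the oriented vertex at a
  negative crossing, and the two columns are the outcome of a split.\<close>

lemma canonical_cycle_coclosed:
  assumes w: "w \<in> braid_words n"
  shows "(\<Sum>g'\<in>gens n w. canonical_cycle n w g' * lee_coeff n w g g') = 0"
proof (cases "\<exists>c\<in>{..<length w} - fst g. oriented_vertex w = insert c (fst g)")
  case True
  then obtain c where c: "c < length w" "c \<notin> fst g"
    and g: "oriented_vertex w = insert c (fst g)" by auto
  have "turnback w (fst g) c' \<longleftrightarrow> c' = c" if "c' < length w" for c'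
  proof -
    have "c' \<in> fst g \<longleftrightarrow> c' \<noteq> c \<and> \<not> snd (w ! c')"
      using g c that unfolding oriented_vertex_def by auto
    moreover have "\<not> snd (w ! c)"
      using g unfolding oriented_vertex_def by auto
    ultimately show ?thesis unfolding turnback_def by auto
  qed
  from circles_oriented_vertex_diff[OF w c(1) this]
  have "lee_edge (circles n w (fst g)) l (circles n w (oriented_vertex w))
        (flip (column w (fst (w ! c))) (column w (Suc (fst (w ! c)))) l')
      \<longleftrightarrow> lee_edge (circles n w (fst g)) l (circles n w (oriented_vertex w)) l'" for l l'
    by (intro lee_edge_flip_target) auto
  then show ?thesis
    by (intro canonical_cycle_orthogonal[OF braid_words_nth[OF w c(1)]])
      (auto simp: lee_coeff_def split: prod.splits)
next
  case False
  have "canonical_cycle n w g' * lee_coeff n w g g' = 0" for g'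
    using False by (cases g; cases g') (auto simp: canonical_cycle_def lee_coeff_def intro!: sum.neutral)
  then show ?thesis by (intro sum.neutral) blast
qed

lemma canonical_cycle_in_lee_cycles:
  assumes "w \<in> braid_words n"
  shows "canonical_cycle n w \<in> lee_cycles n w"
  using canonical_cycle_closed[OF assms]
  by (auto simp: lee_cycles_def chains_def lee_d_def canonical_cycle_def mult.commute)

lemma homologous_refl: "homologous n w x x"
  unfolding homologous_def by (rule bexI[of _ "\<lambda>_. 0"]) (auto simp: lee_d_def chains_def)

text \<open>Pairing with the canonical cycle is a cocycle: coefficientwise, the canonical cycle is also the
  canonical cycle of the mirror image, whose complex is the dual one.\<close>

lemma homologous_canonical_cycle_pairing:
  assumes w: "w \<in> braid_words n" and x: "homologous n w x (canonical_cycle n w)"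
  shows "(\<Sum>g\<in>gens n w. canonical_cycle n w g * x g) \<noteq> 0"
proof -
  let ?s = "canonical_cycle n w"
  let ?G = "gens n w"
  obtain y where "\<And>g. x g - ?s g = lee_d n w y g"
    using x unfolding homologous_def by blast
  then have "x g = ?s g + lee_d n w y g" for g
    by (metis add.commute diff_add_cancel)
  then have "(\<Sum>g\<in>?G. ?s g * x g) = (\<Sum>g\<in>?G. ?s g * ?s g) + (\<Sum>g'\<in>?G. ?s g' * lee_d n w y g')"
    by (simp add: distrib_left sum.distrib)
  also have "(\<Sum>g'\<in>?G. ?s g' * lee_d n w y g')
      = (\<Sum>g'\<in>?G. \<Sum>g\<in>?G. ?s g' * lee_coeff n w g g' * y g)"
    by (rule sum.cong) (auto simp: lee_d_def sum_distrib_left mult.assoc)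
  \<comment> \<open>Exchanging the sums moves the differential onto the canonical cycle as its
    transpose, which annihilates it.\<close>
  also have "\<dots> = (\<Sum>g\<in>?G. (\<Sum>g'\<in>?G. ?s g' * lee_coeff n w g g') * y g)"
    by (subst sum.swap) (simp add: sum_distrib_right)
  also have "\<dots> = 0"
    using canonical_cycle_coclosed[OF w] by simp
  finally have eq: "(\<Sum>g\<in>?G. ?s g * x g) = (\<Sum>g\<in>?G. ?s g * ?s g)" by simp
  \<comment> \<open>A rational sum of squares is positive as soon as one term is nonzero; the
    all-\<open>Plus\<close> labelling supplies such a term.\<close>
  let ?g = "(oriented_vertex w, restrict (\<lambda>_. Plus) (circles n w (oriented_vertex w)))"
  have g: "?g \<in> ?G"
    using oriented_vertex_subset by (auto simp: gens_iff)
  then have "?s ?g \<noteq> 0"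
    by (auto simp: canonical_cycle_def)
  then have "0 < ?s ?g * ?s ?g"
    by (metis linorder_neqE_linordered_idom mult_neg_neg mult_pos_pos)
  with g have "0 < (\<Sum>g\<in>?G. ?s g * ?s g)"
    by (intro sum_pos2[where i = ?g]) auto
  with eq show ?thesis by simp
qed

lemma homologous_canonical_cycle_support:
  assumes "w \<in> braid_words n" "homologous n w x (canonical_cycle n w)"
  obtains l where "(oriented_vertex w, l) \<in> gens n w" "x (oriented_vertex w, l) \<noteq> 0"
proof -
  obtain g where g: "g \<in> gens n w" "canonical_cycle n w g * x g \<noteq> 0"
    using homologous_canonical_cycle_pairing[OF assms] by (meson sum.neutral)
  then have "fst g = oriented_vertex w"
    by (auto simp: canonical_cycle_def split: prod.splits if_splits)
  with g show ?thesis
    by (metis mult_eq_0_iff prod.collapse that)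
qed


section \<open>Gradings\<close>

lemma abs_sgn_val [simp]: "\<bar>sgn_val s\<bar> = 1"
  by (cases s) auto

text \<open>A wrapping circle meets the cut an odd number of times, hence at least once. Distinct
  circles are disjoint, so choosing a crossing point injects the wrapping circles into the
  \<open>n\<close> positions.\<close>

lemma abs_k_grading_le: "\<bar>k_grading n w g\<bar> \<le> int n"
proof -
  obtain v l where g: "g = (v, l)" by force
  let ?W = "{K \<in> circles n w v. wraps n w K}"
  have ex: "\<exists>p\<in>{1..n}. (p, length w) \<in> K" if "wraps n w K" for K
  proof (rule ccontr)
    assume "\<not> ?thesis"
    then have "{p \<in> {1..n}. (p, length w) \<in> K} = {}" by blast
    then have "\<not> wraps n w K"
      unfolding wraps_def by (simp only: card.empty) simp
    with that show False by simp
  qed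
  then obtain f where f: "\<And>K. wraps n w K \<Longrightarrow> f K \<in> {1..n} \<and> (f K, length w) \<in> K"
    by metis
  have "inj_on f ?W"
  proof (rule inj_onI)
    fix K K' assume "K \<in> ?W" "K' \<in> ?W" "f K = f K'"
    then show "K = K'"
      using f[of K] f[of K'] by (intro circles_disjoint[of K n w v K' "(f K, length w)"]) auto
  qed
  then have "card ?W \<le> card {1..n}"
    using f by (intro card_inj_on_le[of f]) auto
  moreover have "\<bar>k_grading n w g\<bar> \<le> (\<Sum>K\<in>?W. \<bar>sgn_val (l K)\<bar>)"
    unfolding k_grading_def g by (simp only: prod.case sum_abs)
  ultimately show ?thesis by simp
qed

lemma wraps_column:
  assumes "p \<in> {1..n}"
  shows "wraps n w (column w p)"
proof -
  have "{q \<in> {1..n}. (q, length w) \<in> column w p} = {p}"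
    using assms by (auto simp: column_def)
  then show ?thesis by (simp add: wraps_def)
qed

text \<open>All circles wrap, so the label sum is \<open>k\<close>; the remaining shift is
  \<open>n_neg + n_pos - 2 * n_neg\<close>.\<close>

lemma j_grading_oriented_vertex:
  "j_grading n w (oriented_vertex w, l) = k_grading n w (oriented_vertex w, l) + writhe w"
proof -
  have "{K \<in> circles n w (oriented_vertex w). wraps n w K} = circles n w (oriented_vertex w)"
    using wraps_column by (auto simp: circles_oriented_vertex)
  moreover have "card (oriented_vertex w) = n_neg w"
    by (simp add: oriented_vertex_def n_neg_def)
  ultimately show ?thesis
    by (simp add: j_grading_def k_grading_def writhe_def)
qed


section \<open>Selecting from families of lines\<close>

text \<open>Meant for the relation "below on all of an interval", which is not antisymmetric on
  indices, so the order-theoretic \<open>Min\<close> does not apply to it.\<close>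

lemma finite_total_preorder_least:
  assumes "finite A" "A \<noteq> {}"
    and total: "\<And>x y. x \<in> A \<Longrightarrow> y \<in> A \<Longrightarrow> R x y \<or> R y x"
    and trans: "\<And>x y z. x \<in> A \<Longrightarrow> y \<in> A \<Longrightarrow> z \<in> A \<Longrightarrow> R x y \<Longrightarrow> R y z \<Longrightarrow> R x z"
  shows "\<exists>x\<in>A. \<forall>y\<in>A. R x y"
  using assms
proof (induction A rule: finite_ne_induct)
  case (singleton x)
  then show ?case by blast
next
  case (insert x A)
  have "\<exists>a\<in>A. \<forall>y\<in>A. R a y"
  proof (rule insert.IH)
    show "R y z \<or> R z y" if "y \<in> A" "z \<in> A" for y z
      using insert.prems(1)[of y z] that by simp
    show "R u z" if "u \<in> A" "y \<in> A" "z \<in> A" "R u y" "R y z" for u y z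
      using insert.prems(2)[of u y z] that by simp
  qed
  then obtain a where a: "a \<in> A" "\<forall>y\<in>A. R a y" by blast
  have xx: "R x x" using insert.prems(1)[of x x] by simp
  show ?case
  proof (cases "R a x")
    case True
    with a show ?thesis by blast
  next
    case False
    then have "R x a" using insert.prems(1)[of x a] a(1) by simp
    then have "\<forall>y\<in>A. R x y"
      using a insert.prems(2)[of x a] by simp
    with xx show ?thesis by simp
  qed
qed

lemma Min_uniform:
  fixes f :: "'a \<Rightarrow> real \<Rightarrow> real"
  assumes "finite A" "A \<noteq> {}"
    and "\<And>x y. x \<in> A \<Longrightarrow> y \<in> A \<Longrightarrow> (\<forall>t\<in>I. f x t \<le> f y t) \<or> (\<forall>t\<in>I. f y t \<le> f x t)"
  shows "\<exists>x\<in>A. \<forall>t\<in>I. Min {f y t | y. y \<in> A} = f x t"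
proof -
  have "\<exists>x\<in>A. \<forall>y\<in>A. \<forall>t\<in>I. f x t \<le> f y t"
    by (rule finite_total_preorder_least[OF assms(1,2)]) (use assms(3) in \<open>simp\<close>, meson order_trans)
  then obtain x where x: "x \<in> A" "\<forall>y\<in>A. \<forall>t\<in>I. f x t \<le> f y t" by blast
  have "Min {f y t | y. y \<in> A} = f x t" if "t \<in> I" for t
    using assms(1) x that by (intro Min_eqI) auto
  with x(1) show ?thesis by blast
qed

lemma Max_uniform:
  fixes f :: "'a \<Rightarrow> real \<Rightarrow> real"
  assumes "finite A" "A \<noteq> {}"
    and "\<And>x y. x \<in> A \<Longrightarrow> y \<in> A \<Longrightarrow> (\<forall>t\<in>I. f x t \<le> f y t) \<or> (\<forall>t\<in>I. f y t \<le> f x t)"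
  shows "\<exists>x\<in>A. \<forall>t\<in>I. Max {f y t | y. y \<in> A} = f x t"
proof -
  have "\<exists>x\<in>A. \<forall>y\<in>A. \<forall>t\<in>I. f y t \<le> f x t"
    by (rule finite_total_preorder_least[OF assms(1,2)]) (use assms(3) in \<open>simp\<close>, meson order_trans)
  then obtain x where x: "x \<in> A" "\<forall>y\<in>A. \<forall>t\<in>I. f y t \<le> f x t" by blast
  have "Max {f y t | y. y \<in> A} = f x t" if "t \<in> I" for t
    using assms(1) x that by (intro Max_eqI) auto
  with x(1) show ?thesis by blast
qed

text \<open>Two lines of integer intercept whose slopes differ by a divisor of \<open>N\<close> can only cross at
  multiples of \<open>1 / N\<close>.\<close>

lemma lines_ordered:
  fixes N :: nat and i b b' k k' :: int
  assumes N: "0 < N" and dvd: "k = k' \<or> k - k' dvd int N"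
  defines "I \<equiv> {real_of_int i / real N..(real_of_int i + 1) / real N}"
  shows "(\<forall>t\<in>I. of_int b - t * of_int k \<le> of_int b' - t * of_int k')
    \<or> (\<forall>t\<in>I. of_int b' - t * of_int k' \<le> of_int b - t * of_int k)"
  using dvd
proof
  assume "k = k'"
  then show ?thesis by (cases "b \<le> b'") auto
next
  assume "k - k' dvd int N"
  then obtain q where q: "int N = (k - k') * q" by auto
  then have q0: "q \<noteq> 0" using N by auto
  have qr: "real N = (real_of_int k - real_of_int k') * real_of_int q"
    using q by (metis of_int_diff of_int_mult of_int_of_nat_eq)
  have t: "real_of_int i \<le> t * real N" "t * real N \<le> real_of_int (i + 1)" if "t \<in> I" for t
    using that N unfolding I_def by (auto simp: field_simps)
  \<comment> \<open>Scaled by \<open>q\<close>, the difference of the lines is an integer minus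
    \<open>t * N\<close>. Since \<open>t * N\<close> stays in \<open>[i, i + 1]\<close>, this has
    constant sign, and the sign of \<open>q\<close> then decides which line is on top.\<close>
  have diff: "(of_int b - t * of_int k) * of_int q - (of_int b' - t * of_int k') * of_int q
      = real_of_int ((b - b') * q) - t * real N" for t
    unfolding qr by (simp add: algebra_simps)
  consider "(b - b') * q \<le> i" | "i + 1 \<le> (b - b') * q" by linarith
  then show ?thesis
  proof cases
    case 1
    then have "real_of_int ((b - b') * q) \<le> real_of_int i"
      by (simp only: of_int_le_iff)
    then have "(of_int b - t * of_int k) * of_int q \<le> (of_int b' - t * of_int k') * real_of_int q"
      if "t \<in> I" for t
      using diff[of t] t[OF that] by linarith
    then show ?thesis
      using q0 by (cases "0 < q") (auto simp: mult_le_cancel_right)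
  next
    case 2
    then have "real_of_int (i + 1) \<le> real_of_int ((b - b') * q)"
      by (simp only: of_int_le_iff)
    then have "(of_int b' - t * of_int k') * of_int q \<le> (of_int b - t * of_int k) * real_of_int q"
      if "t \<in> I" for t
      using diff[of t] t[OF that] by linarith
    then show ?thesis
      using q0 by (cases "0 < q") (auto simp: mult_le_cancel_right)
  qed
qed


section \<open>The shape on small intervals\<close>

lemma finite_jt_gen: "finite {jt_gen n w t g | g. g \<in> gens n w \<and> x g \<noteq> 0}"
  by (rule finite_subset[of _ "jt_gen n w t ` gens n w"]) auto

lemma jt_chain_le: "g \<in> gens n w \<Longrightarrow> x g \<noteq> 0 \<Longrightarrow> jt_chain n w t x \<le> jt_gen n w t g"
  unfolding jt_chain_def by (rule Min_le[OF finite_jt_gen]) blast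

lemma jt_chain_in:
  assumes "g \<in> gens n w" "x g \<noteq> 0"
  obtains h where "h \<in> gens n w" "x h \<noteq> 0" "jt_chain n w t x = jt_gen n w t h"
proof -
  have "jt_chain n w t x \<in> {jt_gen n w t g | g. g \<in> gens n w \<and> x g \<noteq> 0}"
    unfolding jt_chain_def using assms by (intro Min_in finite_jt_gen) blast
  then show ?thesis using that by blast
qed

context
  fixes n :: nat and w :: braid_word
  assumes w: "w \<in> braid_words n"
begin

abbreviation representatives :: "chain set" where
  "representatives \<equiv> {x \<in> lee_cycles n w. homologous n w x (canonical_cycle n w)}"

lemma canonical_cycle_representative: "canonical_cycle n w \<in> representatives"
  using canonical_cycle_in_lee_cycles[OF w] homologous_refl by simp

lemma representative_support:
  assumes "x \<in> representatives"
  obtains l where "(oriented_vertex w, l) \<in> gens n w" "x (oriented_vertex w, l) \<noteq> 0"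
  using homologous_canonical_cycle_support[OF w] assms by blast

lemma jt_chain_in_range:
  assumes "x \<in> representatives"
  shows "jt_chain n w t x \<in> jt_gen n w t ` gens n w"
proof -
  obtain l where "(oriented_vertex w, l) \<in> gens n w" "x (oriented_vertex w, l) \<noteq> 0"
    using representative_support[OF assms] .
  then obtain h where "h \<in> gens n w" "jt_chain n w t x = jt_gen n w t h"
    by (rule jt_chain_in)
  then show ?thesis by simp
qed

text \<open>The class may have infinitely many representatives, but their values lie among those of
  finitely many generators, so the \<open>Max\<close> defining \<open>annular_d\<close> is
  attained.\<close>

lemma finite_jt_chain: "finite {jt_chain n w t x | x. x \<in> representatives}"
  using jt_chain_in_range
  by (auto intro!: finite_subset[OF _ finite_imageI[OF finite_gens], of _ "jt_gen n w t" n w])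

lemma annular_d_eq: "annular_d n w t = Max {jt_chain n w t x | x. x \<in> representatives}"
  by (simp add: annular_d_def)

lemma jt_gen_oriented_vertex:
  "jt_gen n w t (oriented_vertex w, l)
    = of_int (writhe w) + (1 - t) * of_int (k_grading n w (oriented_vertex w, l))"
  by (simp add: jt_gen_def j_grading_oriented_vertex algebra_simps)

lemma abs_jt_gen_oriented_vertex:
  assumes "t \<in> {0..1}"
  shows "\<bar>jt_gen n w t (oriented_vertex w, l) - of_int (writhe w)\<bar> \<le> real n"
proof -
  let ?k = "k_grading n w (oriented_vertex w, l)"
  have "\<bar>real_of_int ?k\<bar> \<le> real n"
    using abs_k_grading_le[of n w "(oriented_vertex w, l)"] by linarith
  moreover have "\<bar>1 - t\<bar> * \<bar>real_of_int ?k\<bar> \<le> 1 * \<bar>real_of_int ?k\<bar>"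
    using assms by (intro mult_right_mono) auto
  ultimately show ?thesis
    by (simp add: jt_gen_oriented_vertex abs_mult)
qed

lemma annular_d_bounds:
  assumes t: "t \<in> {0..1}"
  shows "\<bar>annular_d n w t - of_int (writhe w)\<bar> \<le> real n"
proof -
  have "jt_chain n w t x \<le> of_int (writhe w) + real n" if x: "x \<in> representatives" for x
  proof -
    obtain l where l: "(oriented_vertex w, l) \<in> gens n w" "x (oriented_vertex w, l) \<noteq> 0"
      using representative_support[OF x] .
    have "jt_chain n w t x \<le> jt_gen n w t (oriented_vertex w, l)"
      using l by (intro jt_chain_le)
    also have "\<dots> \<le> of_int (writhe w) + real n"
      using abs_jt_gen_oriented_vertex[OF t, of l] by linarith
    finally show ?thesis .
  qed
  then have upper: "annular_d n w t \<le> of_int (writhe w) + real n"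
    unfolding annular_d_eq
    using canonical_cycle_representative by (intro Max.boundedI finite_jt_chain) auto
  \<comment> \<open>For the lower bound, all terms of the canonical cycle lie at the oriented
    vertex.\<close>
  have "of_int (writhe w) - real n \<le> jt_gen n w t g" if "canonical_cycle n w g \<noteq> 0" for g
  proof -
    have "g = (oriented_vertex w, snd g)"
      using that by (auto simp: canonical_cycle_def split: prod.splits if_splits)
    then show ?thesis
      using abs_jt_gen_oriented_vertex[OF t, of "snd g"] unfolding abs_diff_le_iff by metis
  qed
  moreover obtain l where "(oriented_vertex w, l) \<in> gens n w" "canonical_cycle n w (oriented_vertex w, l) \<noteq> 0"
    using representative_support[OF canonical_cycle_representative] .
  then obtain h where "canonical_cycle n w h \<noteq> 0"
      "jt_chain n w t (canonical_cycle n w) = jt_gen n w t h"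
    by (rule jt_chain_in)
  ultimately have "of_int (writhe w) - real n \<le> jt_chain n w t (canonical_cycle n w)"
    by simp
  also have "\<dots> \<le> annular_d n w t"
    unfolding annular_d_eq
    using canonical_cycle_representative by (intro Max_ge finite_jt_chain) auto
  finally show ?thesis
    using upper by linarith
qed

text \<open>Slopes differ by at most \<open>2 * n\<close> in absolute value, and every positive
  integer up to \<open>2 * n\<close> divides the factorial.\<close>

lemma jt_gen_ordered:
  fixes i :: int
  defines "I \<equiv> {of_int i / fact (2 * n)..(of_int i + 1) / fact (2 * n)}"
  shows "(\<forall>t\<in>I. jt_gen n w t g \<le> jt_gen n w t g') \<or> (\<forall>t\<in>I. jt_gen n w t g' \<le> jt_gen n w t g)"
proof -
  let ?k = "k_grading n w g" and ?k' = "k_grading n w g'"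
  have "?k = ?k' \<or> ?k - ?k' dvd int (fact (2 * n))"
  proof (cases "?k = ?k'")
    case False
    have "\<bar>?k - ?k'\<bar> \<le> int (2 * n)"
      using abs_k_grading_le[of n w g] abs_k_grading_le[of n w g'] by linarith
    then have "nat \<bar>?k - ?k'\<bar> dvd fact (2 * n)"
      using False by (intro dvd_fact) linarith+
    then have "\<bar>?k - ?k'\<bar> dvd int (fact (2 * n))"
      by (metis int_dvd_int_iff int_nat_eq abs_ge_zero)
    then show ?thesis by simp
  qed simp
  from lines_ordered[OF fact_gt_zero this, of i "j_grading n w g" "j_grading n w g'"]
  show ?thesis unfolding I_def jt_gen_def by simp
qed

lemma annular_d_linear:
  fixes i :: int
  shows "\<exists>b k :: int. \<forall>t\<in>{of_int i / fact (2 * n)..(of_int i + 1) / fact (2 * n)}.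
    annular_d n w t - of_int (writhe w) = of_int b - t * of_int k"
proof -
  let ?I = "{of_int i / fact (2 * n)..(of_int i + 1) / fact (2 * n)} :: real set"
  define R where "R = representatives"
  have R: "R \<noteq> {}"
    using canonical_cycle_representative by (auto simp: R_def)
  have "\<exists>g. g \<in> gens n w \<and> (\<forall>t\<in>?I. jt_chain n w t x = jt_gen n w t g)" if x: "x \<in> R" for x
  proof -
    obtain l where "(oriented_vertex w, l) \<in> gens n w" "x (oriented_vertex w, l) \<noteq> 0"
      using representative_support x unfolding R_def .
    then have "\<exists>g\<in>{g \<in> gens n w. x g \<noteq> 0}. \<forall>t\<in>?I.
        Min {jt_gen n w t h | h. h \<in> {g \<in> gens n w. x g \<noteq> 0}} = jt_gen n w t g"
      by (intro Min_uniform jt_gen_ordered) auto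
    then show ?thesis by (auto simp: jt_chain_def)
  qed
  then have "\<forall>x\<in>R. \<exists>g. g \<in> gens n w \<and> (\<forall>t\<in>?I. jt_chain n w t x = jt_gen n w t g)" by blast
  from bchoice[OF this] obtain s where
    s: "\<forall>x\<in>R. s x \<in> gens n w \<and> (\<forall>t\<in>?I. jt_chain n w t x = jt_gen n w t (s x))" by blast
  \<comment> \<open>\<open>R\<close> may be infinite; replacing each representative by its selected
    generator gives the finite index set that \<open>Max_uniform\<close> requires.\<close>
  have "finite (s ` R)"
    using s by (auto intro!: finite_subset[OF _ finite_gens[of n w]])
  then have "\<exists>g\<in>s ` R. \<forall>t\<in>?I. Max {jt_gen n w t h | h. h \<in> s ` R} = jt_gen n w t g"
    using R by (intro Max_uniform jt_gen_ordered) auto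
  then obtain g where g: "\<forall>t\<in>?I. Max {jt_gen n w t h | h. h \<in> s ` R} = jt_gen n w t g" by blast
  have "annular_d n w t = jt_gen n w t g" if t: "t \<in> ?I" for t
  proof -
    have "{jt_chain n w t x | x. x \<in> R} = {jt_gen n w t h | h. h \<in> s ` R}"
      unfolding Setcompr_eq_image image_image using s t by (intro image_cong) blast+
    then have "annular_d n w t = Max {jt_gen n w t h | h. h \<in> s ` R}"
      by (simp only: annular_d_eq R_def)
    also have "\<dots> = jt_gen n w t g"
      using g t by (rule bspec)
    finally show ?thesis .
  qed
  then show ?thesis
    by (intro exI[of _ "j_grading n w g - writhe w"] exI[of _ "k_grading n w g"])
      (auto simp: jt_gen_def)
qed

end


section \<open>Piecewise linear interpolation\<close>

text \<open>Between two consecutive nodes only their two hat functions are nonzero: in the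
  coordinate \<open>N * t\<close> every other node is at distance at least 1.\<close>

lemma pl_function_interpolation:
  fixes i :: nat
  assumes i: "Suc i < length ys" and N: "real N = real (length ys - 1)"
    and t: "t \<in> {real i / real N..real (Suc i) / real N}"
  shows "pl_function ys t
    = of_rat (ys ! i) * (1 - (real N * t - real i)) + of_rat (ys ! Suc i) * (real N * t - real i)"
proof -
  have N0: "0 < N" "Suc i \<le> N" using i N by auto
  then have ti: "real i \<le> real N * t" "real N * t \<le> real i + 1"
    using t by (auto simp: field_simps)
  have "0 \<le> real i / real N" "real (Suc i) / real N \<le> 1"
    using N0 by (auto simp: divide_le_eq)
  with t have t01: "t \<in> {0..1}"
    unfolding atLeastAtMost_iff by linarith
  define h where "h m = of_rat (ys ! m) * max 0 (1 - \<bar>real N * t - real m\<bar>)" for m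
  have "pl_function ys t = (\<Sum>m<length ys. h m)"
    using t01 by (simp add: pl_function_def h_def N)
  also have "\<dots> = (\<Sum>m\<in>{i, Suc i}. h m)"
  proof (rule sum.mono_neutral_right)
    show "\<forall>m\<in>{..<length ys} - {i, Suc i}. h m = 0"
    proof
      fix m assume "m \<in> {..<length ys} - {i, Suc i}"
      then have "real m \<le> real i - 1 \<or> real i + 2 \<le> real m" by auto
      then have "1 \<le> \<bar>real N * t - real m\<bar>" using ti by linarith
      then show "h m = 0" by (simp add: h_def max_def)
    qed
  qed (use i in auto)
  also have "\<dots> = h i + h (Suc i)" by simp
  also have "h i = of_rat (ys ! i) * (1 - (real N * t - real i))"
    using ti by (simp add: h_def)
  also have "h (Suc i) = of_rat (ys ! Suc i) * (real N * t - real i)"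
    using ti by (simp add: h_def)
  finally show ?thesis .
qed

lemma piecewise_linear_pl_function: "piecewise_linear (pl_function ys)"
proof (cases "2 \<le> length ys")
  \<comment> \<open>Lists with at most one entry give a constant: the empty sum is 0, and for one
    entry the only hat is identically 1.\<close>
  case False
  then consider "ys = []" | y where "ys = [y]"
    by (cases ys; cases "tl ys") auto
  then obtain c where "\<forall>t\<in>{0..1}. pl_function ys t = c"
    by cases (auto simp: pl_function_def)
  then show ?thesis
    unfolding piecewise_linear_def
    by (intro exI[of _ 1] exI[of _ real] exI[of _ "\<lambda>_. 0"] exI[of _ "\<lambda>_. c"]) auto
next
  case True
  define N where "N = length ys - 1"
  define y where "y i = real_of_rat (ys ! i)" for i
  have "pl_function ys t = (real N * (y (Suc i) - y i)) * t
      + (y i * (1 + real i) - y (Suc i) * real i)"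
    if "i < N" "t \<in> {real i / real N..real (Suc i) / real N}" for i t
    using pl_function_interpolation[of i ys N t] that
    by (simp add: N_def y_def algebra_simps)
  moreover have "0 < N" using True by (simp add: N_def)
  ultimately show ?thesis
    unfolding piecewise_linear_def
    by (intro exI[of _ N] exI[of _ "\<lambda>i. real i / real N"]
        exI[of _ "\<lambda>i. real N * (y (Suc i) - y i)"]
        exI[of _ "\<lambda>i. y i * (1 + real i) - y (Suc i) * real i"])
      (auto simp: divide_strict_right_mono)
qed

lemma shape_eq_pl_function:
  assumes w: "w \<in> braid_words n"
  shows "\<exists>q. (\<forall>i. \<bar>q i\<bar> \<le> int (n * fact (2 * n))) \<and>
    shape n w = pl_function (map (\<lambda>i. Fract (q i) (int (fact (2 * n)))) [0..<Suc (fact (2 * n))])"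
proof -
  define N :: nat where "N = fact (2 * n)"
  have N: "0 < N" by (simp add: N_def)
  define F where "F t = annular_d n w t - of_int (writhe w)" for t
  have "\<exists>b k :: int. \<forall>t\<in>{real i / real N..real (Suc i) / real N}. F t = of_int b - t * of_int k" for i
    using annular_d_linear[OF w, of "int i"] by (simp add: F_def N_def add.commute)
  then obtain b k :: "nat \<Rightarrow> int" where
    bk: "\<And>i t. t \<in> {real i / real N..real (Suc i) / real N} \<Longrightarrow> F t = of_int (b i) - t * of_int (k i)"
    by metis
  \<comment> \<open>The numerator of \<open>F (i / N)\<close> over the denominator \<open>N\<close>;
    the value 0 beyond the last node makes the bound hold for every \<open>i\<close>.\<close>
  define q where "q i = (if i \<le> N then b i * int N - int i * k i else 0)" for i
  have F: "F (real i / real N) = of_int (q i) / real N" if "i \<le> N" for i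
    using bk[of "real i / real N" i] N that by (simp add: q_def field_simps)
  have q: "\<bar>q i\<bar> \<le> int (n * N)" for i
  proof (cases "i \<le> N")
    case True
    then have "real i / real N \<in> {0..1}" using N by auto
    from annular_d_bounds[OF w this] have "\<bar>of_int (q i) / real N\<bar> \<le> real n"
      using F[OF True] by (simp add: F_def)
    then have "real_of_int \<bar>q i\<bar> \<le> real_of_int (int (n * N))"
      using N by (simp add: field_simps)
    then show ?thesis by (simp only: of_int_le_iff)
  qed (simp add: q_def)
  define ys where "ys = map (\<lambda>i. Fract (q i) (int N)) [0..<Suc N]"
  have ys: "real_of_rat (ys ! i) = F (real i / real N)" if "i \<le> N" for i
  proof -
    have "ys ! i = Fract (q i) (int N)"
      unfolding ys_def using that by (subst nth_map) (auto simp del: upt_Suc)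
    then show ?thesis
      using N F[OF that] by (simp add: of_rat_rat)
  qed
  have "pl_function ys t = F t" if t: "t \<in> {0..1}" for t
  proof -
    obtain i where i: "i < N" "t \<in> {real i / real N..real (Suc i) / real N}"
    proof (cases "t = 1")
      \<comment> \<open>The floor used below would give \<open>i = N\<close> here, so the right
        endpoint is assigned to the last interval.\<close>
      case True
      then show ?thesis
        using N by (intro that[of "N - 1"]) (auto simp: of_nat_diff)
    next
      case False
      define i where "i = nat \<lfloor>t * real N\<rfloor>"
      have i: "real i \<le> t * real N" "t * real N < real i + 1"
        using t by (auto simp: i_def)
      have "t * real N < 1 * real N"
        using t False N by (intro mult_strict_right_mono) auto
      with i(1) have "i < N" by linarith
      with i N show ?thesis
        by (intro that[of i]) (auto simp: field_simps)
    qed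
    have "pl_function ys t = F (real i / real N) * (1 - (real N * t - real i))
        + F (real (Suc i) / real N) * (real N * t - real i)"
      using pl_function_interpolation[of i ys N t] i ys[of i] ys[of "Suc i"]
      by (simp add: ys_def del: upt_Suc)
    also have "F (real i / real N) = of_int (b i) - real i / real N * of_int (k i)"
      using N by (intro bk) (auto simp: divide_right_mono)
    also have "F (real (Suc i) / real N) = of_int (b i) - real (Suc i) / real N * of_int (k i)"
      using N by (intro bk) (auto simp: divide_right_mono)
    also have "(of_int (b i) - real i / real N * of_int (k i)) * (1 - (real N * t - real i))
        + (of_int (b i) - real (Suc i) / real N * of_int (k i)) * (real N * t - real i)
        = of_int (b i) - t * of_int (k i)"
      using N by (simp add: field_simps)
    also have "\<dots> = F t"
      using bk[OF i(2)] by simp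
    finally show ?thesis .
  qed
  then have "shape n w = pl_function ys"
    unfolding shape_def by (intro ext) (auto simp: F_def pl_function_def restrict_def)
  with q show ?thesis
    unfolding ys_def N_def by blast
qed


section \<open>Computability of the enumeration\<close>

text \<open>Arity enters only through the length of the argument list, so functions of every arity
  share one type and composition has a uniform form.\<close>

definition recursive :: "nat \<Rightarrow> (nat list \<Rightarrow> nat) \<Rightarrow> bool" where
  "recursive k f \<longleftrightarrow> (\<exists>e. \<forall>xs. length xs = k \<longrightarrow> rec_eval e xs (f xs))"

lemma recursive_proj: "i < k \<Longrightarrow> recursive k (\<lambda>xs. xs ! i)"
  unfolding recursive_def by (intro exI[of _ "Proj i"]) (auto intro: rec_eval.Proj)

lemma recursive_0: "recursive k (\<lambda>_. 0)"
  unfolding recursive_def by (intro exI[of _ Zero]) (auto intro: rec_eval.Zero)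

lemma recursive_Comp1:
  assumes "recursive 1 (\<lambda>xs. f (xs ! 0))" "recursive k a"
  shows "recursive k (\<lambda>xs. f (a xs))"
proof -
  obtain e e' where e: "\<And>xs. length xs = 1 \<Longrightarrow> rec_eval e xs (f (xs ! 0))"
    and e': "\<And>xs. length xs = k \<Longrightarrow> rec_eval e' xs (a xs)"
    using assms unfolding recursive_def by blast
  have "rec_eval (Comp e [e']) xs (f (a xs))" if "length xs = k" for xs
    using e[of "[a xs]"] e'[OF that] by (intro rec_eval.Comp[of _ _ "[a xs]"]) auto
  then show ?thesis unfolding recursive_def by blast
qed

lemma recursive_Comp2:
  assumes "recursive 2 (\<lambda>xs. f (xs ! 0) (xs ! 1))" "recursive k a" "recursive k b"
  shows "recursive k (\<lambda>xs. f (a xs) (b xs))"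
proof -
  obtain e e1 e2 where e: "\<And>xs. length xs = 2 \<Longrightarrow> rec_eval e xs (f (xs ! 0) (xs ! 1))"
    and e1: "\<And>xs. length xs = k \<Longrightarrow> rec_eval e1 xs (a xs)"
    and e2: "\<And>xs. length xs = k \<Longrightarrow> rec_eval e2 xs (b xs)"
    using assms unfolding recursive_def by blast
  have "rec_eval (Comp e [e1, e2]) xs (f (a xs) (b xs))" if "length xs = k" for xs
    using e[of "[a xs, b xs]"] e1[OF that] e2[OF that]
    by (intro rec_eval.Comp[of _ _ "[a xs, b xs]"]) auto
  then show ?thesis unfolding recursive_def by blast
qed

lemma recursive_Suc:
  assumes "recursive k a"
  shows "recursive k (\<lambda>xs. Suc (a xs))"
proof (rule recursive_Comp1[OF _ assms])
  have "rec_eval Succ xs (Suc (xs ! 0))" if "length xs = 1" for xs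
    using that by (cases xs) (auto intro: rec_eval.Succ)
  then show "recursive 1 (\<lambda>xs. Suc (xs ! 0))" unfolding recursive_def by blast
qed

lemma recursive_PrimRec1:
  assumes g: "recursive 2 (\<lambda>xs. g (xs ! 0) (xs ! 1))"
    and f: "f 0 = 0" "\<And>m. f (Suc m) = g m (f m)"
  shows "recursive 1 (\<lambda>xs. f (xs ! 0))"
proof -
  obtain e where e: "\<And>xs. length xs = 2 \<Longrightarrow> rec_eval e xs (g (xs ! 0) (xs ! 1))"
    using g unfolding recursive_def by blast
  \<comment> \<open>At 0 the base function receives the empty list, which \<open>Zero\<close>
    accepts.\<close>
  have "rec_eval (PrimRec Zero e) [m] (f m)" for m
  proof (induction m)
    case 0
    then show ?case unfolding f by (intro rec_eval.PrimRec_0 rec_eval.Zero)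
  next
    case (Suc m)
    then show ?case
      unfolding f using e[of "[m, f m]"] by (intro rec_eval.PrimRec_Suc) auto
  qed
  then have "rec_eval (PrimRec Zero e) xs (f (xs ! 0))" if "length xs = 1" for xs
    using that by (cases xs) auto
  then show ?thesis unfolding recursive_def by blast
qed

lemma recursive_PrimRec2:
  assumes h: "recursive 1 (\<lambda>xs. h (xs ! 0))"
    and g: "recursive 3 (\<lambda>xs. g (xs ! 0) (xs ! 1) (xs ! 2))"
    and f: "\<And>x. f 0 x = h x" "\<And>m x. f (Suc m) x = g m (f m x) x"
  shows "recursive 2 (\<lambda>xs. f (xs ! 0) (xs ! 1))"
proof -
  obtain d e where d: "\<And>xs. length xs = 1 \<Longrightarrow> rec_eval d xs (h (xs ! 0))"
    and e: "\<And>xs. length xs = 3 \<Longrightarrow> rec_eval e xs (g (xs ! 0) (xs ! 1) (xs ! 2))"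
    using h g unfolding recursive_def by blast
  have *: "rec_eval (PrimRec d e) [m, x] (f m x)" for m x
  proof (induction m)
    case 0
    then show ?case unfolding f using d[of "[x]"] by (intro rec_eval.PrimRec_0) auto
  next
    case (Suc m)
    then show ?case
      unfolding f using e[of "[m, f m x, x]"]
      by (intro rec_eval.PrimRec_Suc) (auto simp: numeral_2_eq_2)
  qed
  have "rec_eval (PrimRec d e) xs (f (xs ! 0) (xs ! 1))" if "length xs = 2" for xs
  proof -
    have "xs = [xs ! 0, xs ! 1]"
      using that by (auto simp: list_eq_iff_nth_eq less_Suc_eq numeral_2_eq_2)
    with *[of "xs ! 0" "xs ! 1"] show ?thesis by simp
  qed
  then show ?thesis unfolding recursive_def by blast
qed

lemma recursive_add:
  assumes "recursive k a" "recursive k b"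
  shows "recursive k (\<lambda>xs. a xs + b xs)"
proof (rule recursive_Comp2[OF _ assms])
  show "recursive 2 (\<lambda>xs. xs ! 0 + xs ! 1)"
    by (rule recursive_PrimRec2[where h = "\<lambda>x. x" and g = "\<lambda>m r x. Suc r"])
      (auto intro!: recursive_proj recursive_Suc)
qed

lemma recursive_mult:
  assumes "recursive k a" "recursive k b"
  shows "recursive k (\<lambda>xs. a xs * b xs)"
proof (rule recursive_Comp2[OF _ assms])
  show "recursive 2 (\<lambda>xs. xs ! 0 * xs ! 1)"
    by (rule recursive_PrimRec2[where h = "\<lambda>x. 0" and g = "\<lambda>m r x. x + r"])
      (auto intro!: recursive_proj recursive_add recursive_0)
qed

lemma recursive_prod_encode:
  assumes "recursive k a" "recursive k b"
  shows "recursive k (\<lambda>xs. prod_encode (a xs, b xs))"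
proof -
  have "recursive 1 (\<lambda>xs. triangle (xs ! 0))"
    by (rule recursive_PrimRec1[where g = "\<lambda>m r. r + Suc m"])
      (auto intro!: recursive_proj recursive_add recursive_Suc)
  from recursive_add[OF recursive_Comp1[OF this recursive_add[OF assms]] assms(1)]
  show ?thesis by (simp add: prod_encode_def)
qed

text \<open>The factorial is shifted by one because \<open>recursive_PrimRec1\<close> starts from \<open>0\<close>.\<close>

lemma recursive_fact:
  assumes "recursive k a"
  shows "recursive k (\<lambda>xs. fact (a xs))"
proof -
  have "recursive 1 (\<lambda>xs. fact (xs ! 0) - 1)"
    \<comment> \<open>With r = m! - 1, one has (m + 1)! - 1 = (m + 1) (r + 1) - 1 = r + m (r +
      1).\<close>
    by (rule recursive_PrimRec1[where g = "\<lambda>m r. r + m * Suc r"])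
      (auto intro!: recursive_proj recursive_add recursive_mult recursive_Suc
        simp: algebra_simps Suc_diff_le fact_ge_1)
  from recursive_Suc[OF recursive_Comp1[OF this assms]]
  show ?thesis by simp
qed

section \<open>Bounds for codes of lists and rationals\<close>

lemma triangle_mono: "m \<le> n \<Longrightarrow> triangle m \<le> triangle n"
  by (induction n) (auto simp: le_Suc_eq)

lemma prod_encode_mono: "a \<le> c \<Longrightarrow> b \<le> d \<Longrightarrow> prod_encode (a, b) \<le> prod_encode (c, d)"
  unfolding prod_encode_def by (auto intro!: add_mono triangle_mono)

text \<open>This is the code of the list of \<open>m\<close> copies of \<open>x\<close>; as pairing
  is monotone, it dominates the code of every list of length \<open>m\<close> with entries at most
  \<open>x\<close>.\<close>

fun list_code_bound :: "nat \<Rightarrow> nat \<Rightarrow> nat" where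
  "list_code_bound 0 x = 0"
| "list_code_bound (Suc m) x = Suc (prod_encode (x, list_code_bound m x))"

lemma list_encode_le_bound:
  "(\<And>y. y \<in> set ys \<Longrightarrow> y \<le> x) \<Longrightarrow> list_encode ys \<le> list_code_bound (length ys) x"
  by (induction ys) (auto intro!: prod_encode_mono)

lemma recursive_list_code_bound:
  assumes "recursive k a" "recursive k b"
  shows "recursive k (\<lambda>xs. list_code_bound (a xs) (b xs))"
proof (rule recursive_Comp2[OF _ assms])
  show "recursive 2 (\<lambda>xs. list_code_bound (xs ! 0) (xs ! 1))"
    by (rule recursive_PrimRec2[where h = "\<lambda>x. 0" and g = "\<lambda>m r x. Suc (prod_encode (x, r))"])
      (auto intro!: recursive_proj recursive_prod_encode recursive_Suc recursive_0)
qed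

text \<open>The code of the descending list from \<open>m - 1\<close> to 0, the order in which
  primitive recursion prepends entries.\<close>

fun all_codes_below :: "nat \<Rightarrow> nat" where
  "all_codes_below 0 = 0"
| "all_codes_below (Suc m) = Suc (prod_encode (m, all_codes_below m))"

lemma set_all_codes_below: "set (list_decode (all_codes_below m)) = {..<m}"
proof -
  have "all_codes_below m = list_encode (rev [0..<m])"
    by (induction m) auto
  then show ?thesis by auto
qed

lemma recursive_all_codes_below:
  assumes "recursive k a"
  shows "recursive k (\<lambda>xs. all_codes_below (a xs))"
proof (rule recursive_Comp1[OF _ assms])
  show "recursive 1 (\<lambda>xs. all_codes_below (xs ! 0))"
    by (rule recursive_PrimRec1[where g = "\<lambda>m r. Suc (prod_encode (m, r))"])
      (auto intro!: recursive_proj recursive_prod_encode recursive_Suc)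
qed

text \<open>An upper bound for the codes of the rationals \<open>q / N\<close> with \<open>\<bar>q\<bar> \<le> n N\<close>, where \<open>N = (2 n)!\<close>.\<close>

definition rat_code_bound :: "nat \<Rightarrow> nat" where
  "rat_code_bound n =
    prod_encode (Suc (n * fact (2 * n) + n * fact (2 * n)), Suc (fact (2 * n) + fact (2 * n)))"

text \<open>The inner successor counts the \<open>N + 1\<close> nodes of a subdivision into
  \<open>N = (2 n)!\<close> intervals; the outer one includes the bound itself, since
  \<open>all_codes_below\<close> is strict.\<close>

definition shape_codes :: "nat \<Rightarrow> nat" where
  "shape_codes n = all_codes_below (Suc (list_code_bound (Suc (fact (2 * n))) (rat_code_bound n)))"

lemma computable_shape_codes: "computable shape_codes"
proof -
  have x: "recursive 1 (\<lambda>xs. xs ! 0)" by (rule recursive_proj) simp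
  have "recursive 1 (\<lambda>xs. xs ! 0 + xs ! 0)" by (intro recursive_add x)
  then have f: "recursive 1 (\<lambda>xs. fact (2 * xs ! 0))"
    unfolding mult_2 by (rule recursive_fact)
  have "recursive 1 (\<lambda>xs. shape_codes (xs ! 0))"
    unfolding shape_codes_def rat_code_bound_def
    by (intro recursive_all_codes_below recursive_list_code_bound recursive_prod_encode
        recursive_Suc recursive_add recursive_mult x f)
  then obtain e where e: "\<And>xs. length xs = 1 \<Longrightarrow> rec_eval e xs (shape_codes (xs ! 0))"
    unfolding recursive_def by blast
  show ?thesis
    unfolding computable_def using e[of "[_]"] by (intro exI[of _ e]) simp
qed

lemma int_encode_le: "int_encode i \<le> Suc (2 * nat \<bar>i\<bar>)"
  by (auto simp: int_encode_def sum_encode_def)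

lemma shapes_subset: "shapes n \<subseteq> set (decode_pl_list (shape_codes n))"
proof
  fix F assume "F \<in> shapes n"
  then obtain B w where "B \<in> braid_group n" "w \<in> B" and F: "F = shape n w"
    unfolding shapes_def by blast
  then have "w \<in> braid_words n"
    unfolding braid_group_def by (auto simp: quotient_def dest: braid_eq_words)
  define N :: nat where "N = fact (2 * n)"
  obtain q where q: "\<And>i. \<bar>q i\<bar> \<le> int (n * N)"
    and shape: "shape n w = pl_function (map (\<lambda>i. Fract (q i) (int N)) [0..<Suc N])"
    using shape_eq_pl_function[OF \<open>w \<in> braid_words n\<close>] unfolding N_def by blast
  \<comment> \<open>\<open>nat_to_rat_surj\<close> decodes a pair as numerator and denominator
    without asking for lowest terms, so \<open>r i\<close> is a code of
    \<open>q i / N\<close>.\<close>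
  define r where "r i = prod_encode (int_encode (q i), int_encode (int N))" for i
  have r: "r i \<le> rat_code_bound n" for i
    unfolding r_def rat_code_bound_def N_def[symmetric]
    using int_encode_le[of "q i"] int_encode_le[of "int N"] q[of i]
    by (intro prod_encode_mono) linarith+
  define c where "c = list_encode (map r [0..<Suc N])"
  have "c \<le> list_code_bound (length (map r [0..<Suc N])) (rat_code_bound n)"
    unfolding c_def using r by (intro list_encode_le_bound) auto
  then have "c \<in> set (list_decode (shape_codes n))"
    unfolding shape_codes_def set_all_codes_below N_def by simp
  moreover have "F = pl_function (map nat_to_rat_surj (list_decode c))"
    unfolding F shape by (simp add: c_def r_def nat_to_rat_surj_def comp_def)
  ultimately show "F \<in> set (decode_pl_list (shape_codes n))"
    unfolding decode_pl_list_def by auto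
qed

theorem theorem3p5:
  shows "(\<forall>n\<ge>1. finite (shapes n)) \<and>
    (\<exists>alg :: nat \<Rightarrow> nat. computable alg \<and>
      (\<forall>n\<ge>1. (\<forall>F \<in> set (decode_pl_list (alg n)). piecewise_linear F) \<and>
             shapes n \<subseteq> set (decode_pl_list (alg n))))"
proof (intro conjI allI impI exI[of _ shape_codes] ballI)
  fix n :: nat
  show "finite (shapes n)"
    using shapes_subset by (rule finite_subset) simp
  show "shapes n \<subseteq> set (decode_pl_list (shape_codes n))"
    by (rule shapes_subset)
  show "piecewise_linear F" if "F \<in> set (decode_pl_list (shape_codes n))" for F
    using that piecewise_linear_pl_function by (auto simp: decode_pl_list_def)
qed (rule computable_shape_codes)

end
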